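(* Let $A\in\mathbb{C}^{n\times n}$ and $\boldsymbol{B}\in\mathbb{C}^{n\times s}$, and let $m\ge 1$. (1) If $\boldsymbol{V}_1,\dots,\boldsymbol{V}_m$ is a nested orthonormal basis of the block Krylov subspace $\mathcal{K}^{\square}_m(A,\boldsymbol{B})$, then $\boldsymbol{V}_k=P_{k-1}(A)\circ\boldsymbol{B}$ for $k=1,\dots,m$, where $P_0,\dots,P_{m-1}$ are orthonormal matrix polynomials with respect to $\langle\!\langle\cdot,\cdot\rangle\!\rangle_{A,\boldsymbol{B}}$ (that is, there exist such polynomials). (2) If $P_0(z),\dots,P_{m-1}(z)$ are orthonormal matrix polynomials with respect to $\langle\!\langle\cdot,\cdot\rangle\!\rangle_{A,\boldsymbol{B}}$, then the block vectors $\boldsymbol{V}_k=P_{k-1}(A)\circ\boldsymbol{B}$, $k=1,\dots,m$, form a nested orthonormal basis of $\mathcal{K}^{\square}_m(A,\boldsymbol{B})$.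
   Context: A matrix polynomial is $P(z)=\sum_{k=0}^{d}z^kC_k$ with $C_k\in\mathbb{C}^{s\times s}$; its action is $P(A)\circ\boldsymbol{B}=\sum_{k=0}^{d}A^k\boldsymbol{B}C_k\in\mathbb{C}^{n\times s}$. Its degree is the largest $k$ with $C_k\neq 0$. For $\boldsymbol{X}_1,\dots,\boldsymbol{X}_m\in\mathbb{C}^{n\times s}$, $\operatorname{blockspan}\{\boldsymbol{X}_1,\dots,\boldsymbol{X}_m\}=\{\sum_{k=1}^m\boldsymbol{X}_kC_k:\ C_k\in\mathbb{C}^{s\times s}\}$. The block Krylov subspace is $\mathcal{K}^{\square}_m(A,\boldsymbol{B})=\operatorname{blockspan}\{\boldsymbol{B},A\boldsymbol{B},\dots,A^{m-1}\boldsymbol{B}\}$. A sequence $\boldsymbol{V}_1,\dots,\boldsymbol{V}_m\in\mathbb{C}^{n\times s}$ is orthonormal if $\boldsymbol{V}_i^*\boldsymbol{V}_j=\delta_{i,j}I_s$ for all $i,j$; it is a basis of $\mathcal{K}^{\square}_m(A,\boldsymbol{B})$ if $\mathcal{K}^{\square}_m(A,\boldsymbol{B})=\operatorname{blockspan}\{\boldsymbol{V}_1,\dots,\boldsymbol{V}_m\}$; the basis is nested if $\mathcal{K}^{\square}_k(A,\boldsymbol{B})=\operatorname{blockspan}\{\boldsymbol{V}_1,\dots,\boldsymbol{V}_k\}$ for all $k=1,\dots,m$. The matrix-valued inner product on $s\times s$ matrix polynomials induced by $(A,\boldsymbol{B})$ is $\langle\!\langle P,Q\rangle\!\rangle_{A,\boldsymbol{B}}=(P(A)\circ\boldsymbol{B})^*\,(Q(A)\circ\boldsymbol{B})\in\mathbb{C}^{s\times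 s}$. Matrix polynomials $P_0,\dots,P_{m-1}$ are called orthonormal matrix polynomials with respect to it if $\deg P_k=k$ and $\langle\!\langle P_i,P_j\rangle\!\rangle_{A,\boldsymbol{B}}=\delta_{i,j}I_s$ for all $i,j$. *)

theory Defs
  imports "HOL-Analysis.Analysis" "HOL-Computational_Algebra.Polynomial"
begin

text \<open>
  Since \<open>complex^'s^'n\<close> is row-indexed by \<open>'n\<close>, it is the type of \<open>n \<times> s\<close> matrices.
  The library operations \<open>*\<close> and \<open>^\<close> on this type act entrywise, so matrix products are
  written with \<open>**\<close> and powers need a definition of their own.
\<close>

primrec mat_pow :: "'a::semiring_1^'n^'n \<Rightarrow> nat \<Rightarrow> 'a^'n^'n" where
  "mat_pow A 0 = mat 1"
| "mat_pow A (Suc k) = A ** mat_pow A k"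

definition conj_transpose :: "complex^'s^'n \<Rightarrow> complex^'n^'s" where
  "conj_transpose X = map_matrix cnj (transpose X)"

definition blockspan :: "'i set \<Rightarrow> ('i \<Rightarrow> complex^'s^'n) \<Rightarrow> (complex^'s^'n) set" where
  "blockspan I X = {\<Sum>k\<in>I. X k ** C k | C :: 'i \<Rightarrow> complex^'s^'s. True}"

definition block_krylov ::
    "complex^'n^'n \<Rightarrow> complex^'s^'n \<Rightarrow> nat \<Rightarrow> (complex^'s^'n) set" where
  "block_krylov A B m = blockspan {..<m} (\<lambda>j. mat_pow A j ** B)"

text \<open>
  A matrix polynomial is an element of \<open>(complex^'s^'s) poly\<close>; only its coefficient sequence and
  its degree are used, not the ring structure or evaluation of the library, which would
  be entrywise.
\<close>

definition matpoly_apply ::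
    "(complex^'s^'s) poly \<Rightarrow> complex^'n^'n \<Rightarrow> complex^'s^'n \<Rightarrow> complex^'s^'n" where
  "matpoly_apply P A B = (\<Sum>k\<le>degree P. mat_pow A k ** B ** coeff P k)"

definition block_inner ::
    "complex^'n^'n \<Rightarrow> complex^'s^'n \<Rightarrow> (complex^'s^'s) poly \<Rightarrow> (complex^'s^'s) poly \<Rightarrow>
     complex^'s^'s" where
  "block_inner A B P Q = conj_transpose (matpoly_apply P A B) ** matpoly_apply Q A B"

text \<open>Block vectors are numbered from \<open>1\<close>; values of \<open>V\<close> outside \<open>{1..m}\<close> are irrelevant.\<close>

definition orthonormal_blocks :: "nat \<Rightarrow> (nat \<Rightarrow> complex^'s^'n) \<Rightarrow> bool" where
  "orthonormal_blocks m V \<longleftrightarrow>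
     (\<forall>i\<in>{1..m}. \<forall>j\<in>{1..m}. conj_transpose (V i) ** V j = (if i = j then mat 1 else 0))"

definition krylov_basis ::
    "complex^'n^'n \<Rightarrow> complex^'s^'n \<Rightarrow> nat \<Rightarrow> (nat \<Rightarrow> complex^'s^'n) \<Rightarrow> bool" where
  "krylov_basis A B m V \<longleftrightarrow> block_krylov A B m = blockspan {1..m} V"

definition nested_orthonormal_krylov_basis ::
    "complex^'n^'n \<Rightarrow> complex^'s^'n \<Rightarrow> nat \<Rightarrow> (nat \<Rightarrow> complex^'s^'n) \<Rightarrow> bool" where
  "nested_orthonormal_krylov_basis A B m V \<longleftrightarrow>
     orthonormal_blocks m V \<and> krylov_basis A B m V \<and>
     (\<forall>k\<in>{1..m}. block_krylov A B k = blockspan {1..k} V)"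

text \<open>
  The condition \<open>P k \<noteq> 0\<close> is part of \<open>deg P\<^sub>k = k\<close>: the library sets \<open>degree 0 = 0\<close>,
  whereas the zero matrix polynomial has no largest index with nonzero coefficient.
\<close>

definition orthonormal_matpolys ::
    "complex^'n^'n \<Rightarrow> complex^'s^'n \<Rightarrow> nat \<Rightarrow> (nat \<Rightarrow> (complex^'s^'s) poly) \<Rightarrow> bool" where
  "orthonormal_matpolys A B m P \<longleftrightarrow>
     (\<forall>k<m. P k \<noteq> 0 \<and> degree (P k) = k) \<and>
     (\<forall>i<m. \<forall>j<m. block_inner A B (P i) (P j) = (if i = j then mat 1 else 0))"

end

theory Submission
  imports Defs
begin

text \<open>
  Write \<open>V\<^sub>k\<^sub>+\<^sub>1 = A\<^sup>k B L + W\<close> with \<open>W\<close> in the Krylov space of order \<open>k\<close>. If that space is the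
  block span of \<open>V\<^sub>1, \<dots>, V\<^sub>k\<close>, then \<open>W\<close> is orthogonal to \<open>V\<^sub>k\<^sub>+\<^sub>1\<close>, so orthonormality gives
  \<open>V\<^sub>k\<^sub>+\<^sub>1\<^sup>* A\<^sup>k B L = I\<close>. Hence the leading coefficient \<open>L\<close> is nonzero, which is the degree condition
  in (1), and even invertible, so that \<open>A\<^sup>k B = (V\<^sub>k\<^sub>+\<^sub>1 - W) L\<^sup>-\<^sup>1\<close> lies in the block span of
  \<open>V\<^sub>1, \<dots>, V\<^sub>k\<^sub>+\<^sub>1\<close>, which is the induction step for (2).
\<close>

section \<open>Closure properties of block spans\<close>

lemma sum_matrix_mult_distrib_right:
  fixes F :: "'i \<Rightarrow> complex^'s^'n" and M :: "complex^'t^'s"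
  shows "(\<Sum>i\<in>I. F i) ** M = (\<Sum>i\<in>I. F i ** M)"
  by (induction I rule: infinite_finite_induct)
    (simp_all add: vec_eq_iff matrix_matrix_mult_def distrib_right sum.distrib)

lemma sum_matrix_mult_distrib_left:
  fixes F :: "'i \<Rightarrow> complex^'s^'n" and M :: "complex^'n^'t"
  shows "M ** (\<Sum>i\<in>I. F i) = (\<Sum>i\<in>I. M ** F i)"
  by (induction I rule: infinite_finite_induct) (simp_all add: matrix_add_ldistrib)

lemma blockspan_zero: "0 \<in> blockspan I X"
  unfolding blockspan_def by (auto intro: exI[of _ "\<lambda>_. 0"])

lemma blockspan_add:
  assumes "Y \<in> blockspan I X" "Z \<in> blockspan I X"
  shows "Y + Z \<in> blockspan I X"
proof -
  obtain C D where "Y = (\<Sum>k\<in>I. X k ** C k)" "Z = (\<Sum>k\<in>I. X k ** D k)"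
    using assms unfolding blockspan_def by blast
  then have "Y + Z = (\<Sum>k\<in>I. X k ** (C k + D k))"
    by (simp add: matrix_add_ldistrib sum.distrib)
  then show ?thesis
    unfolding blockspan_def by (intro CollectI exI[of _ "\<lambda>k. C k + D k"]) simp
qed

lemma blockspan_mult:
  assumes "Y \<in> blockspan I X"
  shows "Y ** M \<in> blockspan I X"
proof -
  obtain C where "Y = (\<Sum>k\<in>I. X k ** C k)"
    using assms unfolding blockspan_def by blast
  then have "Y ** M = (\<Sum>k\<in>I. X k ** (C k ** M))"
    by (simp add: sum_matrix_mult_distrib_right matrix_mul_assoc)
  then show ?thesis
    unfolding blockspan_def by (intro CollectI exI[of _ "\<lambda>k. C k ** M"]) simp
qed

lemma blockspan_diff:
  assumes "Y \<in> blockspan I X" "Z \<in> blockspan I X"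
  shows "Y - Z \<in> blockspan I X"
proof -
  have "Z ** (- mat 1) = - Z"
    by (simp add: vec_eq_iff matrix_matrix_mult_def mat_def sum_negf if_distrib cong: if_cong)
  then show ?thesis
    using blockspan_add[OF assms(1) blockspan_mult[OF assms(2), of "- mat 1"]] by simp
qed

lemma blockspan_base:
  assumes "finite I" "i \<in> I"
  shows "X i \<in> blockspan I X"
proof -
  have "(\<Sum>k\<in>I. X k ** (if k = i then mat 1 else 0)) = (\<Sum>k\<in>I. if k = i then X k else 0)"
    by (intro sum.cong) auto
  then show ?thesis
    using assms unfolding blockspan_def
    by (intro CollectI exI[of _ "\<lambda>k. if k = i then mat 1 else 0"]) simp
qed

lemma blockspan_subset:
  assumes "\<And>i. i \<in> I \<Longrightarrow> X i \<in> blockspan J Y"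
  shows "blockspan I X \<subseteq> blockspan J Y"
proof
  fix Z assume "Z \<in> blockspan I X"
  then obtain C where Z: "Z = (\<Sum>k\<in>I. X k ** C k)"
    unfolding blockspan_def by blast
  have "(\<Sum>k\<in>I. X k ** C k) \<in> blockspan J Y"
    using assms
    \<comment> \<open>An infinite \<open>I\<close> is allowed: its sum is 0 by convention, and 0
      lies in every block span.\<close>
    by (induction I rule: infinite_finite_induct)
      (auto intro: blockspan_zero blockspan_add blockspan_mult)
  then show "Z \<in> blockspan J Y" using Z by simp
qed

lemma blockspan_mono:
  assumes "finite J" "I \<subseteq> J"
  shows "blockspan I X \<subseteq> blockspan J X"
  using assms by (intro blockspan_subset blockspan_base) auto

text \<open>Coefficients act from the right, so the adjoint of \<open>Y\<close> on the left reaches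
  each \<open>X i\<close> directly and kills every term.\<close>

lemma conj_transpose_mult_blockspan:
  assumes "\<And>i. i \<in> I \<Longrightarrow> conj_transpose Y ** X i = 0" "Z \<in> blockspan I X"
  shows "conj_transpose Y ** Z = 0"
  using assms unfolding blockspan_def
  by (auto simp: sum_matrix_mult_distrib_left matrix_mul_assoc)

section \<open>Krylov spaces as images of matrix polynomials\<close>

lemma matpoly_apply_eq_sum:
  assumes "\<And>j. j \<ge> k \<Longrightarrow> coeff P j = 0"
  shows "matpoly_apply P A B = (\<Sum>j<k. mat_pow A j ** B ** coeff P j)"
proof -
  \<comment> \<open>For \<open>k = 0\<close> the polynomial is zero and \<open>{..degree P}\<close>
    is \<open>{0}\<close>, which is not contained in the empty \<open>{..<k}\<close>; summing over
    the union covers this case too.\<close>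
  have "matpoly_apply P A B = (\<Sum>j\<in>{..degree P} \<union> {..<k}. mat_pow A j ** B ** coeff P j)"
    unfolding matpoly_apply_def
    by (intro sum.mono_neutral_left) (auto simp: coeff_eq_0)
  also have "\<dots> = (\<Sum>j<k. mat_pow A j ** B ** coeff P j)"
    using assms by (intro sum.mono_neutral_right) auto
  finally show ?thesis .
qed

lemma matpoly_apply_in_block_krylov:
  assumes "\<And>j. j \<ge> k \<Longrightarrow> coeff P j = 0"
  shows "matpoly_apply P A B \<in> block_krylov A B k"
  unfolding block_krylov_def blockspan_def
  by (intro CollectI exI[of _ "coeff P"]) (simp add: matpoly_apply_eq_sum[of k, OF assms])

lemma block_krylov_matpolyE:
  assumes "Z \<in> block_krylov A B k"
  obtains P where "\<And>j. j \<ge> k \<Longrightarrow> coeff P j = 0" "Z = matpoly_apply P A B"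
proof -
  obtain C where Z: "Z = (\<Sum>j<k. mat_pow A j ** B ** C j)"
    using assms unfolding block_krylov_def blockspan_def by blast
  \<comment> \<open>\<open>Poly\<close> strips trailing zero coefficients, so the degree of
    \<open>P\<close> may fall below \<open>k - 1\<close>; only the vanishing of the coefficients
    from \<open>k\<close> on is promised.\<close>
  define P where "P = Poly (map C [0..<k])"
  have c: "coeff P j = (if j < k then C j else 0)" for j
    by (simp add: P_def coeff_Poly_eq nth_default_def)
  have "matpoly_apply P A B = Z"
    by (subst matpoly_apply_eq_sum[of k]) (simp_all add: c Z)
  with c show thesis by (intro that[of P]) auto
qed

lemma matpoly_apply_lead:
  assumes "degree P = k"
  obtains W where "W \<in> block_krylov A B k"
    "matpoly_apply P A B = W + (mat_pow A k ** B) ** lead_coeff P"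
proof
  show "(\<Sum>j<k. mat_pow A j ** B ** coeff P j) \<in> block_krylov A B k"
    unfolding block_krylov_def blockspan_def by blast
  show "matpoly_apply P A B
      = (\<Sum>j<k. mat_pow A j ** B ** coeff P j) + (mat_pow A k ** B) ** lead_coeff P"
    using assms unfolding matpoly_apply_def by (simp flip: lessThan_Suc_atMost)
qed

section \<open>Consequences of orthonormality\<close>

lemma mat_1_neq_0: "(mat 1 :: complex^'s^'s) \<noteq> 0"
proof
  assume "(mat 1 :: complex^'s^'s) = 0"
  \<comment> \<open>Index types are inhabited, so there is a diagonal entry to compare;
    \<open>undefined\<close> names one.\<close>
  then have "(mat 1 :: complex^'s^'s) $ undefined $ undefined = 0" by simp
  then show False by (simp add: mat_def)
qed

lemma orthonormal_blocksD:
  assumes "orthonormal_blocks m V" "i \<in> {1..m}" "j \<in> {1..m}"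
  shows "conj_transpose (V i) ** V j = (if i = j then mat 1 else 0)"
  using assms unfolding orthonormal_blocks_def by blast

lemma orthonormal_blocks_mult_blockspan:
  assumes "orthonormal_blocks m V" "k < m" "W \<in> blockspan {1..k} V"
  shows "conj_transpose (V (Suc k)) ** W = 0"
proof (rule conj_transpose_mult_blockspan[OF _ assms(3)])
  fix i assume "i \<in> {1..k}"
  then show "conj_transpose (V (Suc k)) ** V i = 0"
    using orthonormal_blocksD[OF assms(1), of "Suc k" i] assms(2) by simp
qed

text \<open>Otherwise \<open>V (Suc k)\<close> would be orthogonal to itself, forcing the identity
  matrix to be 0.\<close>

lemma orthonormal_blocks_not_in_blockspan:
  assumes "orthonormal_blocks m V" "k < m"
  shows "V (Suc k) \<notin> blockspan {1..k} V"
proof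
  assume "V (Suc k) \<in> blockspan {1..k} V"
  then have "conj_transpose (V (Suc k)) ** V (Suc k) = 0"
    by (rule orthonormal_blocks_mult_blockspan[OF assms])
  then show False
    using orthonormal_blocksD[OF assms(1), of "Suc k" "Suc k"] assms(2)
    by (simp add: mat_1_neq_0)
qed

text \<open>One inclusion is a degree count; the other is an induction on \<open>k\<close> that
  recovers each new power from the leading term. It starts at \<open>k = 0\<close>, where both sides
  are the zero space.\<close>

lemma blockspan_eq_block_krylov:
  assumes orth: "orthonormal_blocks m V"
    and deg: "\<And>j. j < m \<Longrightarrow> degree (P j) = j"
    and V: "\<And>j. j < m \<Longrightarrow> V (Suc j) = matpoly_apply (P j) A B"
    and "k \<le> m"
  shows "block_krylov A B k = blockspan {1..k} V"
proof
  show "blockspan {1..k} V \<subseteq> block_krylov A B k"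
    unfolding block_krylov_def
  proof (rule blockspan_subset)
    fix i assume i: "i \<in> {1..k}"
    then have i': "i - 1 < m" "Suc (i - 1) = i" using \<open>k \<le> m\<close> by auto
    then have "V i = matpoly_apply (P (i - 1)) A B" using V by metis
    also have "\<dots> \<in> block_krylov A B k"
      using i i' deg by (intro matpoly_apply_in_block_krylov coeff_eq_0) fastforce
    finally show "V i \<in> blockspan {..<k} (\<lambda>j. mat_pow A j ** B)"
      unfolding block_krylov_def .
  qed
  show "block_krylov A B k \<subseteq> blockspan {1..k} V"
    using \<open>k \<le> m\<close>
  proof (induction k)
    case 0
    then show ?case by (simp add: block_krylov_def blockspan_def)
  next
    case (Suc k)
    have mono: "blockspan {1..k} V \<subseteq> blockspan {1..Suc k} V"
      by (intro blockspan_mono) auto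
    define L where "L = lead_coeff (P k)"
    obtain W where W: "W \<in> block_krylov A B k"
      and VW: "V (Suc k) = W + (mat_pow A k ** B) ** L"
      using matpoly_apply_lead[of "P k" k A B] V deg Suc.prems unfolding L_def by auto
    have Wspan: "W \<in> blockspan {1..k} V" using W Suc by auto
    have orthW: "conj_transpose (V (Suc k)) ** W = 0"
      using orth Suc.prems Wspan by (intro orthonormal_blocks_mult_blockspan) auto
    have "mat 1 = conj_transpose (V (Suc k)) ** V (Suc k)"
      using orthonormal_blocksD[OF orth, of "Suc k" "Suc k"] Suc.prems by simp
    also have "\<dots> = conj_transpose (V (Suc k)) ** W
        + conj_transpose (V (Suc k)) ** ((mat_pow A k ** B) ** L)"
      by (subst (2) VW) (rule matrix_add_ldistrib)
    finally have "conj_transpose (V (Suc k)) ** (mat_pow A k ** B) ** L = mat 1"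
      by (simp add: orthW matrix_mul_assoc)
    \<comment> \<open>Both factors are square of size s, so the left inverse of \<open>L\<close>
      just found is also a right inverse; this order is the one that cancels \<open>L\<close>
      below.\<close>
    then have "L ** (conj_transpose (V (Suc k)) ** (mat_pow A k ** B)) = mat 1"
      (is "L ** ?M = _") by (simp add: matrix_left_right_inverse)
    then have "mat_pow A k ** B = ((mat_pow A k ** B) ** L) ** ?M"
      by (simp flip: matrix_mul_assoc)
    then have "mat_pow A k ** B = (V (Suc k) - W) ** ?M"
      using VW by simp
    also have "\<dots> \<in> blockspan {1..Suc k} V"
      using Wspan mono by (intro blockspan_mult blockspan_diff blockspan_base) auto
    finally have new: "mat_pow A k ** B \<in> blockspan {1..Suc k} V" .
    \<comment> \<open>Lower powers are generators of the Krylov space of order \<open>k\<close>,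
      which the induction hypothesis covers.\<close>
    have old: "mat_pow A i ** B \<in> blockspan {1..Suc k} V" if "i < k" for i
      using that blockspan_base[of "{..<k}" i "\<lambda>j. mat_pow A j ** B"] Suc mono
      unfolding block_krylov_def by auto
    show ?case
      unfolding block_krylov_def
      by (rule blockspan_subset) (use new old less_Suc_eq in auto)
  qed
qed

section \<open>From bases to polynomials and back\<close>

lemma nested_orthonormal_krylov_basis_imp_matpolys:
  fixes A :: "complex^'n^'n" and B :: "complex^'s^'n"
  assumes "nested_orthonormal_krylov_basis A B m V"
  obtains P where "orthonormal_matpolys A B m P"
    "\<And>k. k < m \<Longrightarrow> V (Suc k) = matpoly_apply (P k) A B"
proof -
  have orth: "orthonormal_blocks m V"
    and span: "\<And>k. k \<in> {1..m} \<Longrightarrow> block_krylov A B k = blockspan {1..k} V"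
    using assms unfolding nested_orthonormal_krylov_basis_def by auto
  have "\<exists>P. P \<noteq> 0 \<and> degree P = k \<and> V (Suc k) = matpoly_apply P A B" if "k < m" for k
  proof -
    have "V (Suc k) \<in> block_krylov A B (Suc k)"
      using span[of "Suc k"] that blockspan_base[of "{1..Suc k}" "Suc k" V] by simp
    then obtain P where P: "\<And>j. j \<ge> Suc k \<Longrightarrow> coeff P j = 0" "V (Suc k) = matpoly_apply P A B"
      using block_krylov_matpolyE by blast
    \<comment> \<open>Nestedness speaks only of \<open>k\<close> from 1 on; for \<open>k = 0\<close>
      both spans are empty sums.\<close>
    have "block_krylov A B k = blockspan {1..k} V"
      using span[of k] that by (cases k) (auto simp: block_krylov_def blockspan_def)
    then have "V (Suc k) \<notin> block_krylov A B k"
      using orthonormal_blocks_not_in_blockspan[OF orth that] by simp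
    \<comment> \<open>If all coefficients from \<open>k\<close> on vanished,
      \<open>V (Suc k)\<close> would lie in the Krylov space of order \<open>k\<close>. Those beyond
      \<open>k\<close> do vanish, which leaves \<open>k\<close> itself.\<close>
    then have "\<exists>j\<ge>k. coeff P j \<noteq> 0"
      using matpoly_apply_in_block_krylov[of k P A B] P(2) by auto
    then have lead: "coeff P k \<noteq> 0"
      using P(1) by (metis le_antisym not_less_eq_eq)
    have "degree P \<le> k"
      using P(1) by (intro degree_le) auto
    then have "degree P = k"
      using le_degree[OF lead] by simp
    moreover have "P \<noteq> 0" using lead by auto
    ultimately show ?thesis using P(2) by blast
  qed
  then obtain P where P: "\<And>k. k < m \<Longrightarrow> P k \<noteq> 0 \<and> degree (P k) = k \<and>
      V (Suc k) = matpoly_apply (P k) A B"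
    by metis
  have "block_inner A B (P i) (P j) = (if i = j then mat 1 else 0)" if "i < m" "j < m" for i j
    using that P[of i] P[of j]
      orthonormal_blocksD[OF orth, of "Suc i" "Suc j"]
    by (simp add: block_inner_def)
  with P show thesis
    by (intro that[of P]) (auto simp: orthonormal_matpolys_def)
qed

text \<open>Orthonormality transfers because \<open>block_inner\<close> is the product of the
  corresponding blocks; the span equality at \<open>k = m\<close> is the basis property.\<close>

lemma orthonormal_matpolys_imp_nested_basis:
  assumes P: "orthonormal_matpolys A B m P"
    and V: "\<And>k. k < m \<Longrightarrow> V (Suc k) = matpoly_apply (P k) A B"
  shows "nested_orthonormal_krylov_basis A B m V"
proof -
  have orth: "orthonormal_blocks m V"
    unfolding orthonormal_blocks_def
  proof (intro ballI)
    fix i j assume "i \<in> {1..m}" "j \<in> {1..m}"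
    then obtain i' j' where "i = Suc i'" "j = Suc j'" "i' < m" "j' < m"
      by (cases i; cases j) auto
    then show "conj_transpose (V i) ** V j = (if i = j then mat 1 else 0)"
      using P V unfolding orthonormal_matpolys_def block_inner_def by auto
  qed
  have "block_krylov A B k = blockspan {1..k} V" if "k \<le> m" for k
    using blockspan_eq_block_krylov[OF orth _ V that] P by (auto simp: orthonormal_matpolys_def)
  with orth show ?thesis
    by (auto simp: nested_orthonormal_krylov_basis_def krylov_basis_def)
qed

theorem theorem3p1:
  fixes A :: "complex^'n^'n" and B :: "complex^'s^'n" and m :: nat
  assumes "m \<ge> 1"
  shows "(\<forall>V. nested_orthonormal_krylov_basis A B m V \<longrightarrow>
            (\<exists>P. orthonormal_matpolys A B m P \<and>
                 (\<forall>k\<in>{1..m}. V k = matpoly_apply (P (k - 1)) A B)))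
       \<and> (\<forall>P V. orthonormal_matpolys A B m P \<longrightarrow>
            (\<forall>k\<in>{1..m}. V k = matpoly_apply (P (k - 1)) A B) \<longrightarrow>
            nested_orthonormal_krylov_basis A B m V)"
proof (intro conjI allI impI)
  fix V assume "nested_orthonormal_krylov_basis A B m V"
  then obtain P where P: "orthonormal_matpolys A B m P"
    and V: "\<And>k. k < m \<Longrightarrow> V (Suc k) = matpoly_apply (P k) A B"
    using nested_orthonormal_krylov_basis_imp_matpolys by blast
  have "V k = matpoly_apply (P (k - 1)) A B" if "k \<in> {1..m}" for k
    using V[of "k - 1"] that by (cases k) auto
  with P show "\<exists>P. orthonormal_matpolys A B m P \<and>
                 (\<forall>k\<in>{1..m}. V k = matpoly_apply (P (k - 1)) A B)"
    by blast
next
  fix P V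
  assume "orthonormal_matpolys A B m P"
    and "\<forall>k\<in>{1..m}. V k = matpoly_apply (P (k - 1)) A B"
  then show "nested_orthonormal_krylov_basis A B m V"
    by (intro orthonormal_matpolys_imp_nested_basis) auto
qed

end
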